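(* Let $p$ be an odd prime and let $q\in\mathbb{C}_p$ with $|1-q|_p<1$. Let $s\in\mathbb{N}$ and $n_1,\dots,n_s,k\in\mathbb{Z}_+$ with $n_1+\cdots+n_s>sk$. Then $$\int_{\mathbb{Z}_p}\Big(\prod_{i=1}^{s}B_{k,n_i}(x)\Big)q^{1-x}\,d\mu_{-1}(x)=\begin{cases}2q+E_{n_1+\cdots+n_s,q}, & k=0,\\[1mm] \Big(\displaystyle\prod_{i=1}^{s}\binom{n_i}{k}\Big)\displaystyle\sum_{j=0}^{sk}\binom{sk}{j}(-1)^{sk+j}E_{n_1+\cdots+n_s-j,q}, & k>0.\end{cases}$$
   Context: $\mathbb{C}_p$ denotes the completion of an algebraic closure of $\mathbb{Q}_p$; $\mathbb{N}=\{1,2,\dots\}$, $\mathbb{Z}_+=\{0,1,2,\dots\}$. For $q\in\mathbb{C}_p$ with $|1-q|_p<1$, the $q$-Euler numbers $E_{n,q}$ are defined by $\frac{2}{qe^t+1}=\sum_{n\ge0}E_{n,q}\frac{t^n}{n!}$ (formal power series in $t$). For $x\in\mathbb{Z}_p$, $q^x=\sum_{r\ge0}\binom{x}{r}(q-1)^r$ and $q^{1-x}=q\cdot(q^{-1})^x$. Binomial coefficients are $\binom{n}{k}=\frac{n(n-1)\cdots(n-k+1)}{k!}$ (zero when $k>n$), and the Bernstein polynomial is $B_{k,n}(x)=\binom{n}{k}x^k(1-x)^{n-k}$, regarded as a polynomial function on $\mathbb{Z}_p$ (the zero polynomial when $k>n$). For a uniformly differentiable $f:\mathbb{Z}_p\to\mathbb{C}_p$,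 the fermionic $p$-adic integral is $\int_{\mathbb{Z}_p}f(x)\,d\mu_{-1}(x)=\lim_{N\to\infty}\sum_{x=0}^{p^N-1}f(x)(-1)^x$. *)

theory Defs
  imports "HOL-Analysis.Analysis" "HOL-Computational_Algebra.Computational_Algebra"
begin

text \<open>Fields of characteristic 0 with a multiplicative non-archimedean absolute value inducing the
  metric. The library's \<open>norm\<close> cannot be used here, as it is restricted to real normed vector spaces.\<close>

class valued_field = field_char_0 + metric_space +
  fixes absv :: "'a \<Rightarrow> real"
  assumes dist_absv: "dist x y = absv (x - y)"
    and absv_mult: "absv (x * y) = absv x * absv y"
    and absv_add_le_max: "absv (x + y) \<le> max (absv x) (absv y)"

definition padic_abs :: "nat \<Rightarrow> rat \<Rightarrow> real" where
  "padic_abs p r = (if r = 0 then 0 else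
     (case quotient_of r of (a, b) \<Rightarrow>
        real p powi (int (multiplicity (int p) b) - int (multiplicity (int p) a))))"

definition is_subfield :: "'a::field set \<Rightarrow> bool" where
  "is_subfield A \<longleftrightarrow> 0 \<in> A \<and> 1 \<in> A \<and>
     (\<forall>x\<in>A. \<forall>y\<in>A. x - y \<in> A \<and> x * y \<in> A) \<and> (\<forall>x\<in>A. inverse x \<in> A)"

definition is_alg_closure_of :: "'a::field set \<Rightarrow> 'a set \<Rightarrow> bool" where
  "is_alg_closure_of A F \<longleftrightarrow> is_subfield F \<and> is_subfield A \<and> F \<subseteq> A \<and>
     (\<forall>x\<in>A. \<exists>f. f \<noteq> 0 \<and> set (coeffs f) \<subseteq> F \<and> poly f x = 0) \<and>
     (\<forall>f. set (coeffs f) \<subseteq> A \<and> degree f > 0 \<longrightarrow> (\<exists>x\<in>A. poly f x = 0))"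

definition is_completion_of :: "'a::metric_space set \<Rightarrow> 'a set \<Rightarrow> bool" where
  "is_completion_of K A \<longleftrightarrow> A \<subseteq> K \<and> complete K \<and> K \<subseteq> closure A"

text \<open>The type \<open>'a\<close> is a copy of \<open>\<complex>\<^sub>p\<close>: the completion of an algebraic closure \<open>A\<close> of the completion
  \<open>Qp\<close> of the rationals with respect to the \<open>p\<close>-adic absolute value. A predicate on types is used
  because a HOL type cannot depend on the number \<open>p\<close>.\<close>

definition is_Cp :: "nat \<Rightarrow> 'a::valued_field itself \<Rightarrow> bool" where
  "is_Cp p _ \<longleftrightarrow> (\<forall>r. absv (of_rat r :: 'a) = padic_abs p r) \<and>
     (\<exists>Qp A :: 'a set. is_completion_of Qp (range of_rat) \<and> is_alg_closure_of A Qp \<and>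
        is_completion_of UNIV A)"

definition q_Euler :: "nat \<Rightarrow> 'a::field_char_0 \<Rightarrow> 'a" where
  "q_Euler n q = fact n * fps_nth (fps_const 2 / (fps_const q * fps_exp 1 + 1)) n"

text \<open>Only meaningful for \<open>absv (1 - q) < 1\<close> and \<open>x\<close> in the closure of the integers.\<close>

definition qpow :: "'a::valued_field \<Rightarrow> 'a \<Rightarrow> 'a" where
  "qpow q x = (\<Sum>r. (x gchoose r) * (q - 1) ^ r)"

definition bernstein :: "nat \<Rightarrow> nat \<Rightarrow> 'a::field_char_0 \<Rightarrow> 'a" where
  "bernstein k n x = of_nat (n choose k) * x ^ k * (1 - x) ^ (n - k)"

text \<open>The integral of \<open>f\<close> over \<open>\<int>\<^sub>p\<close> exists as a limit and equals \<open>I\<close>; only the values of \<open>f\<close> at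
  natural numbers matter, so \<open>f\<close> is taken to be total.\<close>

definition has_fermionic_integral :: "nat \<Rightarrow> ('a::valued_field \<Rightarrow> 'a) \<Rightarrow> 'a \<Rightarrow> bool" where
  "has_fermionic_integral p f I \<longleftrightarrow>
     (\<lambda>N. \<Sum>x<p ^ N. f (of_nat x) * (- 1) ^ x) \<longlonglongrightarrow> I"

end

theory Submission
  imports Defs
begin

text \<open>Telescoping shows that \<open>f(x) + f(x + 1)\<close> has fermionic integral \<open>2 f(0)\<close> as soon as
  \<open>f(p\<^sup>N)\<close> tends to \<open>f(0)\<close>. For \<open>f(x) = (2 - x)\<^sup>n q\<^sup>2\<^sup>-\<^sup>x\<close>, expanding \<open>(2 - x)\<^sup>n\<close> in powers of
  \<open>1 - x\<close> turns this into a recurrence for the integrals of \<open>(1 - x)\<^sup>n q\<^sup>1\<^sup>-\<^sup>x\<close>. Since \<open>1 + q \<noteq> 0\<close>, the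
  recurrence determines them, and for \<open>n > 0\<close> the solution is \<open>2 q + E\<^sub>n\<close>. Expanding \<open>x\<^sup>m\<close> in powers
  of \<open>1 - x\<close> reduces products of Bernstein polynomials to these integrals.\<close>

subsection \<open>Ultrametric absolute values\<close>

lemma absv_zero: "absv (0 :: 'a::valued_field) = 0"
  by (metis diff_self dist_absv dist_self)

lemma absv_nonneg: "0 \<le> absv (x :: 'a::valued_field)"
  by (metis diff_zero dist_absv zero_le_dist)

lemma absv_eq_0_iff: "absv (x :: 'a::valued_field) = 0 \<longleftrightarrow> x = 0"
  by (metis diff_zero dist_absv dist_eq_0_iff)

lemma absv_one: "absv (1 :: 'a::valued_field) = 1"
  by (metis absv_eq_0_iff absv_mult mult_cancel_left1 mult_1 one_neq_zero)

lemma absv_minus_commute: "absv (x - y :: 'a::valued_field) = absv (y - x)"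
  by (metis dist_absv dist_commute)

lemma absv_inverse: "absv (inverse x :: 'a::valued_field) = inverse (absv x)"
  by (metis absv_eq_0_iff absv_mult absv_one inverse_unique inverse_zero right_inverse)

lemma absv_power: "absv (x ^ n :: 'a::valued_field) = absv x ^ n"
  by (induction n) (auto simp: absv_one absv_mult)

lemma absv_sum_le:
  fixes f :: "'b \<Rightarrow> 'a::valued_field"
  assumes "\<And>i. i \<in> A \<Longrightarrow> absv (f i) \<le> c" and "0 \<le> c"
  shows "absv (sum f A) \<le> c"
  using assms(1)
proof (induction A rule: infinite_finite_induct)
  case (insert x F)
  then have "max (absv (f x)) (absv (sum f F)) \<le> c"
    by simp
  with absv_add_le_max have "absv (f x + sum f F) \<le> c"
    by (rule order_trans)
  then show ?case
    using insert.hyps by simp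
qed (simp_all add: absv_zero assms(2))

lemma absv_of_nat_le_one: "absv (of_nat n :: 'a::valued_field) \<le> 1"
  using absv_sum_le[of "{..<n}" "\<lambda>_. 1 :: 'a" 1] by (simp add: absv_one)

lemma absv_eq_one:
  fixes x :: "'a::valued_field"
  assumes "absv (1 - x) < 1"
  shows "absv x = 1"
  using assms absv_add_le_max[of x "1 - x"] absv_add_le_max[of 1 "x - 1"]
  by (auto simp: absv_one absv_minus_commute[of x 1] max_def split: if_splits)

lemma absv_inverse_minus_one_less:
  fixes x :: "'a::valued_field"
  assumes "absv (1 - x) < 1"
  shows "absv (inverse x - 1) < 1"
proof -
  have "x \<noteq> 0"
    using assms by (auto simp: absv_one)
  then have "inverse x - 1 = inverse x * (1 - x)"
    by (simp add: field_simps)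
  then show ?thesis
    using assms absv_eq_one[OF assms] by (simp add: absv_mult absv_inverse)
qed

lemma absv_two_eq_one:
  assumes "odd p" and "absv (of_nat p :: 'a::valued_field) < 1"
  shows "absv (2 :: 'a) = 1"
proof -
  obtain k where k: "p = 2 * k + 1"
    using \<open>odd p\<close> by (rule oddE)
  have "absv (of_nat p - 1 :: 'a) = 1"
    using assms(2) absv_eq_one[of "1 - of_nat p :: 'a"] by (simp add: absv_minus_commute)
  then have "absv (2 :: 'a) * absv (of_nat k :: 'a) = 1"
    by (simp add: k absv_mult)
  moreover have "absv (of_nat k :: 'a) \<le> 1" and "absv (2 :: 'a) \<le> 1"
    using absv_of_nat_le_one[of k, where 'a = 'a] absv_of_nat_le_one[of 2, where 'a = 'a]
    by simp_all
  ultimately show ?thesis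
    using mult_left_le[of "absv (of_nat k :: 'a)" "absv (2 :: 'a)"] by (simp add: absv_nonneg)
qed

lemma one_plus_neq_zero:
  fixes q :: "'a::valued_field"
  assumes "odd p" and "absv (of_nat p :: 'a) < 1" and "absv (1 - q) < 1"
  shows "1 + q \<noteq> 0"
proof
  assume "1 + q = 0"
  then have "1 - q = 2"
    by (metis add_eq_0_iff diff_minus_eq_add one_add_one)
  then show False
    using assms(3) absv_two_eq_one[OF assms(1,2)] by (metis order_less_irrefl)
qed

lemma is_Cp_absv_prime:
  assumes "is_Cp p TYPE('a::valued_field)" and "prime p"
  shows "absv (of_nat p :: 'a) = inverse (real p)"
proof -
  have "p > 1"
    using \<open>prime p\<close> by (rule prime_gt_1_nat)
  then have "multiplicity (int p) (int p) = 1"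
    by (intro multiplicity_self) auto
  moreover have "quotient_of (of_nat p) = (int p, 1)"
    using quotient_of_int[of "int p"] by (simp add: Rat.of_int_def)
  ultimately have "padic_abs p (of_nat p) = inverse (real p)"
    using \<open>p > 1\<close> by (simp add: padic_abs_def power_int_minus)
  moreover have "absv (of_rat (of_nat p) :: 'a) = padic_abs p (of_nat p)"
    using assms(1) unfolding is_Cp_def by blast
  ultimately show ?thesis
    by simp
qed

subsection \<open>Continuity of the field operations\<close>

lemma tendsto_absv_iff:
  fixes l :: "'a::valued_field"
  shows "(f \<longlongrightarrow> l) F \<longleftrightarrow> ((\<lambda>x. absv (f x - l)) \<longlongrightarrow> 0) F"
  by (subst tendsto_dist_iff) (simp add: dist_absv)

lemma tendsto_absv_bound:
  fixes l :: "'a::valued_field"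
  assumes "\<And>x. absv (f x - l) \<le> g x" and "(g \<longlongrightarrow> 0) F"
  shows "(f \<longlongrightarrow> l) F"
  unfolding tendsto_absv_iff
  by (rule Lim_null_comparison[OF _ assms(2)]) (simp add: assms(1) absv_nonneg)

lemma dist_add_add_le:
  fixes a b x y :: "'a::valued_field"
  shows "dist (x + y) (a + b) \<le> dist x a + dist y b"
  using absv_add_le_max[of "x - a" "y - b"] absv_nonneg[of "x - a"] absv_nonneg[of "y - b"]
  by (simp add: dist_absv algebra_simps)

lemma dist_mult_mult_le:
  fixes a b x y :: "'a::valued_field"
  shows "dist (x * y) (a * b) \<le> dist x a * dist y 0 + dist a 0 * dist y b"
proof -
  have "x * y - a * b = (x - a) * y + a * (y - b)"
    by (simp add: algebra_simps)
  then have "absv (x * y - a * b) \<le> max (absv (x - a) * absv y) (absv a * absv (y - b))"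
    by (metis absv_add_le_max absv_mult)
  also have "\<dots> \<le> absv (x - a) * absv y + absv a * absv (y - b)"
    by (simp add: absv_nonneg)
  finally show ?thesis
    by (simp add: dist_absv)
qed

instance valued_field \<subseteq> topological_ab_group_add
proof
  fix a b :: 'a
  show "((\<lambda>x. fst x + snd x) \<longlongrightarrow> a + b) (nhds a \<times>\<^sub>F nhds b)"
  proof (rule tendsto_absv_bound)
    show "absv (fst x + snd x - (a + b)) \<le> dist (fst x) a + dist (snd x) b" for x
      using dist_add_add_le[of "fst x" "snd x" a b] by (simp add: dist_absv)
    have "((\<lambda>x. dist (fst x) a + dist (snd x) b) \<longlongrightarrow> dist a a + dist b b) (nhds a \<times>\<^sub>F nhds b)"
      by (intro tendsto_intros filterlim_fst filterlim_snd)
    then show "((\<lambda>x. dist (fst x) a + dist (snd x) b) \<longlongrightarrow> 0) (nhds a \<times>\<^sub>F nhds b)"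
      by simp
  qed
  show "(uminus \<longlongrightarrow> - a) (nhds a)"
  proof (rule tendsto_absv_bound)
    show "absv (- x - - a) \<le> dist x a" for x
      by (simp add: dist_absv absv_minus_commute[of x])
    show "((\<lambda>x. dist x a) \<longlongrightarrow> 0) (nhds a)"
      using tendsto_dist[OF filterlim_ident tendsto_const, of a a] by simp
  qed
qed

instance valued_field \<subseteq> topological_comm_monoid_mult
proof
  fix a b :: 'a
  let ?g = "\<lambda>x. dist (fst x) a * dist (snd x) 0 + dist a 0 * dist (snd x) b"
  show "((\<lambda>x. fst x * snd x) \<longlongrightarrow> a * b) (nhds a \<times>\<^sub>F nhds b)"
  proof (rule tendsto_absv_bound)
    show "absv (fst x * snd x - a * b) \<le> ?g x" for x
      using dist_mult_mult_le[of "fst x" "snd x" a b] by (simp add: dist_absv)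
    have "(?g \<longlongrightarrow> dist a a * dist b 0 + dist a 0 * dist b b) (nhds a \<times>\<^sub>F nhds b)"
      by (intro tendsto_intros filterlim_fst filterlim_snd)
    then show "(?g \<longlongrightarrow> 0) (nhds a \<times>\<^sub>F nhds b)"
      by simp
  qed
qed

lemma LIMSEQ_power_zero_absv:
  fixes x :: "'a::valued_field"
  assumes "absv x < 1"
  shows "(\<lambda>N. x ^ N) \<longlonglongrightarrow> 0"
  using assms by (simp add: tendsto_absv_iff absv_power absv_nonneg LIMSEQ_power_zero)

lemma absv_power_minus_one_le:
  fixes y :: "'a::valued_field"
  assumes "absv (y - 1) < 1"
  shows "absv (y ^ i - 1) \<le> absv (y - 1)"
proof -
  have "absv y = 1"
    using assms by (intro absv_eq_one) (simp add: absv_minus_commute)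
  then have "absv (\<Sum>j<i. y ^ j) \<le> 1"
    by (intro absv_sum_le) (simp_all add: absv_power)
  then show ?thesis
    by (simp add: power_diff_1_eq absv_mult absv_nonneg mult_left_le)
qed

lemma absv_power_minus_one_le_mult:
  fixes y :: "'a::valued_field"
  assumes "absv (y - 1) < 1"
  shows "absv (y ^ p - 1) \<le> max (absv (y - 1)) (absv (of_nat p :: 'a)) * absv (y - 1)"
proof -
  have "absv (\<Sum>i<p. y ^ i) = absv ((\<Sum>i<p. y ^ i - 1) + of_nat p)"
    by (simp add: sum_subtractf)
  also have "\<dots> \<le> max (absv (\<Sum>i<p. y ^ i - 1)) (absv (of_nat p :: 'a))"
    by (rule absv_add_le_max)
  also have "\<dots> \<le> max (absv (y - 1)) (absv (of_nat p :: 'a))"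
    using assms by (intro max.mono absv_sum_le absv_power_minus_one_le absv_nonneg) simp_all
  finally show ?thesis
    by (simp add: power_diff_1_eq absv_mult absv_nonneg mult.commute mult_left_mono)
qed

lemma LIMSEQ_power_power_one:
  fixes y :: "'a::valued_field"
  assumes y: "absv (y - 1) < 1" and p: "absv (of_nat p :: 'a) < 1"
  shows "(\<lambda>N. y ^ (p ^ N)) \<longlonglongrightarrow> 1"
proof (rule tendsto_absv_bound)
  define c where "c = max (absv (y - 1)) (absv (of_nat p :: 'a))"
  have c: "0 \<le> c" "c < 1"
    using y p absv_nonneg[of "y - 1"] by (auto simp: c_def)
  show "absv (y ^ (p ^ N) - 1) \<le> c ^ N" for N
  proof (induction N)
    case 0
    then show ?case
      using y by simp
  next
    case (Suc N)
    let ?z = "y ^ p ^ N"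
    have z: "absv (?z - 1) \<le> absv (y - 1)"
      using y by (rule absv_power_minus_one_le)
    then have "absv (?z ^ p - 1) \<le> max (absv (?z - 1)) (absv (of_nat p :: 'a)) * absv (?z - 1)"
      using y by (intro absv_power_minus_one_le_mult) linarith
    also have "\<dots> \<le> c * c ^ N"
      using z Suc c by (intro mult_mono) (auto simp: c_def absv_nonneg)
    finally show ?case
      by (simp add: mult.commute flip: power_mult)
  qed
  show "(\<lambda>N. c ^ N) \<longlonglongrightarrow> 0"
    using c by (simp add: LIMSEQ_power_zero)
qed

subsection \<open>The fermionic integral\<close>

lemma has_fermionic_integral_cong:
  assumes "\<And>x. f (of_nat x) = g (of_nat x)"
  shows "has_fermionic_integral p f I \<longleftrightarrow> has_fermionic_integral p g I"
  by (simp add: has_fermionic_integral_def assms)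

lemma has_fermionic_integral_diff:
  assumes "has_fermionic_integral p f I" and "has_fermionic_integral p g J"
  shows "has_fermionic_integral p (\<lambda>x. f x - g x) (I - J)"
  using tendsto_diff[OF assms[unfolded has_fermionic_integral_def]]
  by (simp add: has_fermionic_integral_def left_diff_distrib sum_subtractf)

lemma has_fermionic_integral_mult_right:
  assumes "has_fermionic_integral p f I"
  shows "has_fermionic_integral p (\<lambda>x. c * f x) (c * I)"
  using tendsto_mult_left[OF assms[unfolded has_fermionic_integral_def], of c]
  by (simp add: has_fermionic_integral_def sum_distrib_left mult.assoc)

lemma has_fermionic_integral_sum:
  assumes "\<And>j. j \<in> A \<Longrightarrow> has_fermionic_integral p (f j) (I j)"
  shows "has_fermionic_integral p (\<lambda>x. \<Sum>j\<in>A. f j x) (\<Sum>j\<in>A. I j)"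
proof -
  have "(\<lambda>N. \<Sum>j\<in>A. \<Sum>x<p ^ N. f j (of_nat x) * (- 1) ^ x) \<longlonglongrightarrow> (\<Sum>j\<in>A. I j)"
    using assms by (intro tendsto_sum) (simp add: has_fermionic_integral_def)
  then show ?thesis
    unfolding has_fermionic_integral_def sum_distrib_right by (subst sum.swap)
qed

lemma has_fermionic_integral_add_shift:
  assumes "odd p" and "(\<lambda>N. f (of_nat (p ^ N))) \<longlonglongrightarrow> f 0"
  shows "has_fermionic_integral p (\<lambda>x. f x + f (x + 1)) (2 * f 0)"
proof -
  have "(\<Sum>x<M. (f (of_nat x) + f (of_nat x + 1)) * (- 1) ^ x) = f 0 + f (of_nat M)"
    if "odd M" for M
    using that sum_lessThan_telescope'[of "\<lambda>x. f (of_nat x) * (- 1) ^ x" M]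
    by (simp add: distrib_right add.commute)
  moreover have "(\<lambda>N. f 0 + f (of_nat (p ^ N))) \<longlonglongrightarrow> 2 * f 0"
    unfolding mult_2 using assms(2) by (intro tendsto_add tendsto_const)
  ultimately show ?thesis
    using \<open>odd p\<close> by (simp add: has_fermionic_integral_def)
qed

subsection \<open>Integrals of reflected monomials\<close>

lemma q_Euler_recurrence:
  fixes q :: "'a::field_char_0"
  assumes "1 + q \<noteq> 0"
  shows "q * (\<Sum>k\<le>n. of_nat (n choose k) * q_Euler k q) + q_Euler n q = 2 * of_bool (n = 0)"
proof -
  define w where "w = fps_const q * fps_exp 1 + 1"
  define F where "F = fps_const 2 / w"
  have F_nth: "fps_nth F k = q_Euler k q / fact k" for k
    by (simp add: q_Euler_def F_def w_def)
  have "fps_nth w 0 \<noteq> 0"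
    using assms by (simp add: w_def add.commute)
  then have "F * w = fps_const 2"
    by (simp add: F_def fps_divide_unit mult.assoc inverse_mult_eq_1)
  then have "fps_nth (fps_const q * (F * fps_exp 1) + F) n = fps_nth (fps_const 2) n"
    by (simp add: w_def algebra_simps)
  moreover have "fps_nth (F * fps_exp 1) n = (\<Sum>k\<le>n. q_Euler k q / fact k / fact (n - k))"
    by (simp add: fps_mult_nth F_nth atLeast0AtMost)
  ultimately have "q * (\<Sum>k\<le>n. q_Euler k q / fact k / fact (n - k)) + q_Euler n q / fact n
      = 2 * of_bool (n = 0)"
    by (simp add: F_nth)
  then have "fact n * (q * (\<Sum>k\<le>n. q_Euler k q / fact k / fact (n - k)) + q_Euler n q / fact n)
      = 2 * of_bool (n = 0)"
    by (cases "n = 0") simp_all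
  moreover have "(\<Sum>k\<le>n. of_nat (n choose k) * q_Euler k q)
      = fact n * (\<Sum>k\<le>n. q_Euler k q / fact k / fact (n - k))"
    by (simp add: sum_distrib_left binomial_fact)
  ultimately show ?thesis
    by (simp add: distrib_left mult.left_commute)
qed

text \<open>This is \<open>q\<^sup>2 E\<^sub>n(2)\<close> for the \<open>q\<close>-Euler polynomials \<open>E\<^sub>n(x) = \<Sum>k\<le>n. (n choose k) E\<^sub>k x\<^sup>n\<^sup>-\<^sup>k\<close>.\<close>

definition reflected_q_Euler :: "nat \<Rightarrow> 'a::field_char_0 \<Rightarrow> 'a" where
  "reflected_q_Euler n q = 2 * q + q_Euler n q - 2 * of_bool (n = 0)"

lemma reflected_q_Euler_recurrence:
  fixes q :: "'a::field_char_0"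
  assumes "1 + q \<noteq> 0"
  shows "q * (\<Sum>k\<le>n. of_nat (n choose k) * reflected_q_Euler k q) + reflected_q_Euler n q
    = 2 ^ (n + 1) * q\<^sup>2"
proof -
  let ?E = "\<Sum>k\<le>n. of_nat (n choose k) * q_Euler k q"
  have "(\<Sum>k\<le>n. of_nat (n choose k) * reflected_q_Euler k q)
      = 2 * q * (\<Sum>k\<le>n. of_nat (n choose k)) + ?E
        - 2 * (\<Sum>k\<le>n. of_nat (n choose k) * of_bool (k = 0))"
    by (simp only: reflected_q_Euler_def ring_distribs sum.distrib sum_subtractf sum_distrib_left
        mult_ac)
  also have "(\<Sum>k\<le>n. of_nat (n choose k) :: 'a) = 2 ^ n"
    by (simp add: choose_row_sum flip: of_nat_sum)
  also have "(\<Sum>k\<le>n. of_nat (n choose k) * of_bool (k = 0) :: 'a) = 1"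
    by simp
  finally have "q * (\<Sum>k\<le>n. of_nat (n choose k) * reflected_q_Euler k q) + reflected_q_Euler n q
      = q * (2 * q * 2 ^ n + ?E - 2 * 1) + reflected_q_Euler n q"
    by (simp only:)
  also have "\<dots> = 2 ^ (n + 1) * q\<^sup>2 - 2 * of_bool (n = 0) + (q * ?E + q_Euler n q)"
    by (simp add: reflected_q_Euler_def algebra_simps power2_eq_square)
  finally show ?thesis
    using q_Euler_recurrence[OF assms, of n] by simp
qed

lemma qpow_of_nat: "qpow q (of_nat x) = (q :: 'a::valued_field) ^ x"
proof -
  have "qpow q (of_nat x) = (\<Sum>r\<le>x. (of_nat x gchoose r) * (q - 1) ^ r)"
    unfolding qpow_def
    by (rule suminf_finite) (auto simp: binomial_gbinomial [symmetric] binomial_eq_0)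
  also have "\<dots> = ((q - 1) + 1) ^ x"
    by (subst binomial_ring) (simp add: binomial_gbinomial)
  finally show ?thesis by simp
qed

text \<open>The monomial \<open>x\<^sup>n q\<^sup>x\<close> reflected by \<open>x \<mapsto> 1 - x\<close>.\<close>

definition reflected_monomial :: "'a::valued_field \<Rightarrow> nat \<Rightarrow> 'a \<Rightarrow> 'a" where
  "reflected_monomial q n x = (1 - x) ^ n * (q * qpow (inverse q) x)"

lemma LIMSEQ_reflected_power:
  fixes c d q :: "'a::valued_field"
  assumes p: "absv (of_nat p :: 'a) < 1" and q: "absv (1 - q) < 1"
  shows "(\<lambda>N. (c - of_nat (p ^ N)) ^ n * (d * inverse q ^ (p ^ N))) \<longlonglongrightarrow> c ^ n * d"
proof -
  have "(\<lambda>N. of_nat p ^ N :: 'a) \<longlonglongrightarrow> 0"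
    using p by (rule LIMSEQ_power_zero_absv)
  moreover have "(\<lambda>N. inverse q ^ (p ^ N)) \<longlonglongrightarrow> 1"
    using absv_inverse_minus_one_less[OF q] p by (rule LIMSEQ_power_power_one)
  ultimately have "(\<lambda>N. (c - of_nat p ^ N) ^ n * (d * inverse q ^ (p ^ N))) \<longlonglongrightarrow> (c - 0) ^ n * (d * 1)"
    by (intro tendsto_mult tendsto_power_strong tendsto_diff tendsto_const)
  then show ?thesis
    by simp
qed

lemma has_fermionic_integral_reflected_monomial_recurrence:
  fixes q :: "'a::valued_field"
  assumes "odd p" and "absv (of_nat p :: 'a) < 1" and q: "absv (1 - q) < 1"
  shows "has_fermionic_integral p
    (\<lambda>x. q * (\<Sum>k\<le>n. of_nat (n choose k) * reflected_monomial q k x) + reflected_monomial q n x)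
    (2 ^ (n + 1) * q\<^sup>2)"
proof -
  define f where "f x = (2 - x) ^ n * (q\<^sup>2 * qpow (inverse q) x)" for x
  have f_of_nat: "f (of_nat x) = (2 - of_nat x) ^ n * (q\<^sup>2 * inverse q ^ x)" for x
    by (simp add: f_def qpow_of_nat)
  have f_0: "f 0 = 2 ^ n * q\<^sup>2"
    using f_of_nat[of 0] by simp
  have "q \<noteq> 0"
    using q by (auto simp: absv_one)
  have "(\<lambda>N. f (of_nat (p ^ N))) \<longlonglongrightarrow> f 0"
    unfolding f_of_nat f_0 using assms(2,3) by (rule LIMSEQ_reflected_power)
  then have "has_fermionic_integral p (\<lambda>x. f x + f (x + 1)) (2 * f 0)"
    using \<open>odd p\<close> by (intro has_fermionic_integral_add_shift)
  moreover have "f (of_nat x)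
      = q * (\<Sum>k\<le>n. of_nat (n choose k) * reflected_monomial q k (of_nat x))" for x
  proof -
    have "(2 - of_nat x :: 'a) ^ n = ((1 - of_nat x) + 1) ^ n"
      by simp
    also have "\<dots> = (\<Sum>k\<le>n. of_nat (n choose k) * (1 - of_nat x) ^ k)"
      by (subst binomial_ring) simp
    finally show ?thesis
      by (simp add: f_of_nat reflected_monomial_def qpow_of_nat sum_distrib_left sum_distrib_right
          power2_eq_square mult_ac)
  qed
  moreover have "f (of_nat x + 1) = reflected_monomial q n (of_nat x)" for x
    using \<open>q \<noteq> 0\<close> f_of_nat[of "Suc x"]
    by (simp add: reflected_monomial_def qpow_of_nat power2_eq_square add.commute)
  ultimately show ?thesis
    by (subst has_fermionic_integral_cong[where g = "\<lambda>x. f x + f (x + 1)"])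
      (simp_all add: f_0 mult.assoc)
qed

lemma has_fermionic_integral_reflected_monomial:
  fixes q :: "'a::valued_field"
  assumes "odd p" and "absv (of_nat p :: 'a) < 1" and "absv (1 - q) < 1"
  shows "has_fermionic_integral p (reflected_monomial q n) (reflected_q_Euler n q)"
proof (induction n rule: less_induct)
  case (less n)
  let ?g = "reflected_monomial q"
  have q1: "1 + q \<noteq> 0"
    using assms by (rule one_plus_neq_zero)
  have top_term: "inverse (1 + q) * ((q * (\<Sum>k\<le>n. of_nat (n choose k) * a k) + a n)
      - q * (\<Sum>k<n. of_nat (n choose k) * a k)) = a n" for a :: "nat \<Rightarrow> 'a"
    using q1 by (simp add: field_simps flip: lessThan_Suc_atMost)
  have "has_fermionic_integral p
     (\<lambda>x. inverse (1 + q) * ((q * (\<Sum>k\<le>n. of_nat (n choose k) * ?g k x) + ?g n x)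
       - q * (\<Sum>k<n. of_nat (n choose k) * ?g k x)))
     (inverse (1 + q) * (2 ^ (n + 1) * q\<^sup>2
       - q * (\<Sum>k<n. of_nat (n choose k) * reflected_q_Euler k q)))"
    using less assms
    by (intro has_fermionic_integral_mult_right has_fermionic_integral_diff
        has_fermionic_integral_sum has_fermionic_integral_reflected_monomial_recurrence) auto
  moreover have "inverse (1 + q) * (2 ^ (n + 1) * q\<^sup>2
      - q * (\<Sum>k<n. of_nat (n choose k) * reflected_q_Euler k q)) = reflected_q_Euler n q"
    using top_term[of "\<lambda>k. reflected_q_Euler k q"]
    unfolding reflected_q_Euler_recurrence[OF q1] .
  ultimately show ?case
    by (simp only: top_term[of "\<lambda>k. ?g k x" for x])
qed

subsection \<open>Products of Bernstein polynomials\<close>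

lemma power_mult_one_minus_power_expand:
  fixes x :: "'a::comm_ring_1"
  assumes "m \<le> L"
  shows "x ^ m * (1 - x) ^ (L - m)
    = (\<Sum>j\<le>m. of_nat (m choose j) * (- 1) ^ (m + j) * (1 - x) ^ (L - j))"
proof -
  have "x ^ m = (1 + - (1 - x)) ^ m"
    by simp
  also have "\<dots> = (\<Sum>j\<le>m. of_nat (m choose j) * (- 1) ^ (m - j) * (1 - x) ^ (m - j))"
    by (subst binomial_ring) (simp add: power_minus[of "1 - x"] mult.assoc del: minus_diff_eq)
  finally have "x ^ m * (1 - x) ^ (L - m)
      = (\<Sum>j\<le>m. of_nat (m choose j) * (- 1) ^ (m - j) * ((1 - x) ^ (m - j) * (1 - x) ^ (L - m)))"
    by (simp add: sum_distrib_right mult.assoc)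
  also have "\<dots> = (\<Sum>j\<le>m. of_nat (m choose j) * (- 1) ^ (m + j) * (1 - x) ^ (L - j))"
    using assms by (intro sum.cong) (auto simp: minus_one_power_iff simp flip: power_add)
  finally show ?thesis .
qed

lemma prod_bernstein:
  fixes x :: "'a::field_char_0"
  assumes "finite A"
  shows "(\<Prod>i\<in>A. bernstein k (n i) x)
    = (\<Prod>i\<in>A. of_nat (n i choose k)) * (x ^ (card A * k) * (1 - x) ^ (sum n A - card A * k))"
proof (cases "\<forall>i\<in>A. k \<le> n i")
  case True
  then have "(\<Sum>i\<in>A. n i - k) = sum n A - card A * k"
    by (subst sum_subtractf_nat) auto
  then show ?thesis
    by (simp add: bernstein_def prod.distrib mult.assoc power_mult mult.commute[of "card A"]
        flip: power_sum)
next
  case False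
  then obtain i where "i \<in> A" "n i < k"
    by auto
  then have "(\<Prod>i\<in>A. bernstein k (n i) x) = 0" and "(\<Prod>i\<in>A. of_nat (n i choose k) :: 'a) = 0"
    using assms by (auto simp: bernstein_def intro!: bexI[of _ i])
  then show ?thesis
    by simp
qed

lemma has_fermionic_integral_power_mult_one_minus_power:
  fixes q :: "'a::valued_field"
  assumes "odd p" and "absv (of_nat p :: 'a) < 1" and "absv (1 - q) < 1" and "m < L"
  shows "has_fermionic_integral p (\<lambda>x. x ^ m * (1 - x) ^ (L - m) * (q * qpow (inverse q) x))
    (2 * q * of_bool (m = 0)
      + (\<Sum>j\<le>m. of_nat (m choose j) * (- 1) ^ (m + j) * q_Euler (L - j) q))"
proof -
  let ?b = "\<lambda>j. of_nat (m choose j) * (- 1) ^ (m + j) :: 'a"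
  have "has_fermionic_integral p (reflected_monomial q (L - j)) (2 * q + q_Euler (L - j) q)"
    if "j \<le> m" for j
    using has_fermionic_integral_reflected_monomial[OF assms(1-3), of "L - j"] that \<open>m < L\<close>
    by (simp add: reflected_q_Euler_def)
  then have "has_fermionic_integral p (\<lambda>x. \<Sum>j\<le>m. ?b j * reflected_monomial q (L - j) x)
      (\<Sum>j\<le>m. ?b j * (2 * q + q_Euler (L - j) q))"
    by (intro has_fermionic_integral_sum has_fermionic_integral_mult_right) simp
  moreover have "(\<Sum>j\<le>m. ?b j * reflected_monomial q (L - j) x)
      = x ^ m * (1 - x) ^ (L - m) * (q * qpow (inverse q) x)" for x
    using power_mult_one_minus_power_expand[of m L x] \<open>m < L\<close>
    by (simp add: reflected_monomial_def sum_distrib_right mult.assoc)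
  moreover have "(\<Sum>j\<le>m. ?b j * (2 * q + q_Euler (L - j) q))
      = 2 * q * of_bool (m = 0) + (\<Sum>j\<le>m. ?b j * q_Euler (L - j) q)"
  proof -
    have "(\<Sum>j\<le>m. ?b j) = of_bool (m = 0)"
      using power_mult_one_minus_power_expand[of m m "0 :: 'a", symmetric] by (simp add: power_0_left)
    moreover have "(\<Sum>j\<le>m. ?b j * (2 * q + q_Euler (L - j) q))
        = (\<Sum>j\<le>m. ?b j) * (2 * q) + (\<Sum>j\<le>m. ?b j * q_Euler (L - j) q)"
      by (simp only: distrib_left sum.distrib sum_distrib_right)
    ultimately show ?thesis
      by (simp only: mult.commute)
  qed
  ultimately show ?thesis
    by (simp only:)
qed

theorem theorem8:
  fixes p s k :: nat and n :: "nat \<Rightarrow> nat" and q :: "'a::valued_field"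
  assumes "prime p" and "odd p"
    and "is_Cp p TYPE('a)"
    and "absv (1 - q) < 1"
    and "s \<ge> 1"
    and "(\<Sum>i=1..s. n i) > s * k"
  shows "has_fermionic_integral p
           (\<lambda>x. (\<Prod>i=1..s. bernstein k (n i) x) * (q * qpow (inverse q) x))
           (if k = 0 then 2 * q + q_Euler (\<Sum>i=1..s. n i) q
            else (\<Prod>i=1..s. of_nat (n i choose k)) *
              (\<Sum>j=0..s * k. of_nat ((s * k) choose j) * (- 1) ^ (s * k + j)
                 * q_Euler ((\<Sum>i=1..s. n i) - j) q))"
proof -
  let ?C = "\<Prod>i=1..s. of_nat (n i choose k) :: 'a"
  let ?L = "\<Sum>i=1..s. n i"
  have "absv (of_nat p :: 'a) < 1"
    using is_Cp_absv_prime[OF assms(3,1)] prime_gt_1_nat[OF assms(1)]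
    by (simp add: inverse_less_1_iff)
  then have "has_fermionic_integral p
      (\<lambda>x. ?C * (x ^ (s * k) * (1 - x) ^ (?L - s * k) * (q * qpow (inverse q) x)))
      (?C * (2 * q * of_bool (s * k = 0)
        + (\<Sum>j\<le>s * k. of_nat (s * k choose j) * (- 1) ^ (s * k + j) * q_Euler (?L - j) q)))"
    using assms by (intro has_fermionic_integral_mult_right
        has_fermionic_integral_power_mult_one_minus_power)
  then show ?thesis
    using \<open>s \<ge> 1\<close> by (cases "k = 0") (simp_all add: prod_bernstein mult.assoc atLeast0AtMost)
qed

end
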